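(* Let $F$ be a set of clauses. There exists a regWRTL refutation of $F$ of size $s$ if and only if there is an execution of DLL-Learn$(F,\varnothing)$ that returns UNSAT and performs exactly $s-1$ recursive calls.
   Context: Literals, clauses (finite sets of literals), $\Box$ the empty clause. An assignment $\alpha$ is a partial map from variables to $\{0,1\}$ (a set of pairs $(x,\epsilon)$), $\alpha(\overline x)=1-\alpha(x)$; $F|_\alpha=1$ iff every clause of $F$ has a literal set to $1$; $F|_\alpha=0$ iff some clause $C$ of $F$ has all its literals set to $0$ ($C|_\alpha=0$). For $\epsilon\in\{0,1\}$, $x^0=x$ and $x^1=\overline x$. DLL-Learn$(F,\alpha)$: 1. if $F|_\alpha=1$ return $(F,\alpha)$. 2. if $F|_\alpha=0$, optionally (and necessarily if $\alpha$ assigns all variables of $F$): tag some $C\in F$ with $C|_\alpha=0$ as the new clause and return $(F,\mathrm{UNSAT})$. 3. choose $x\in\mathrm{var}(F)\setminus\mathrm{dom}(\alpha)$ and $\epsilon\in\{0,1\}$; $(G,\beta)\leftarrow$ DLL-Learn$(F,\alpha\cup\{(x,\epsilon)\})$; if $\beta\neq$ UNSAT return $(G,\beta)$; $(H,\gamma)\leftarrow$ DLL-Learn$(G,\alpha\cup\{(x,1-\epsilon)\})$; if $\gamma\ne$ UNSAT return $(H,\gamma)$; let $C_0$ be the clause tagged new by the first recursive call and $C_1$ the one tagged new by the second; let $C=(C_0\setminus\{x^{\epsilon}\})\cup(C_1\setminus\{x^{1-\epsilon}\})$ (the w-resolvent of $C_0$ and $C_1$ on $x$); $H\leftarrow H\cup\{C\}$;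 tag $C$ as the new clause; return $(H,\mathrm{UNSAT})$. All choices are nondeterministic. regWRTL: w-resolution infers $(C_0\setminus\{x\})\cup(C_1\setminus\{\overline x\})$ from arbitrary clauses $C_0,C_1$ and a variable $x$. A regWRTL refutation of $F$ is an ordered binary tree $T$ with post-order $<_T$ (left subtree, then right subtree, then the node) where each leaf $v$ is labeled by a clause of $F$ or by a clause labeling some node $u<_T v$, each internal node by a variable $x$ and the w-resolvent on $x$ of its children's clauses, the root is labeled $\Box$, and no leaf-to-root path contains two inferences on the same variable. Size = number of nodes.
   Formalization: Inference variables of a regWRTL refutation of F are required to be variables of F; otherwise the claim fails, e.g. F = {□} has a refutation of size 3 (resolving □ with □ on a foreign variable), while DLL-Learn makes no recursive call on it. *)

theory Defs
  imports Main
begin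

datatype 'v literal = Pos 'v | Neg 'v

fun var_of :: "'v literal \<Rightarrow> 'v" where
  "var_of (Pos x) = x"
| "var_of (Neg x) = x"

text \<open>Clauses are finite; the type does not enforce this, \<open>clause_set\<close> does. Tautological
  clauses are allowed. The empty clause is \<open>{}\<close>.\<close>

type_synonym 'v clause = "'v literal set"

definition clause_set :: "'v clause set \<Rightarrow> bool" where
  "clause_set F \<longleftrightarrow> (\<forall>C\<in>F. finite C)"

definition vars :: "'v clause set \<Rightarrow> 'v set" where
  "vars F = var_of ` \<Union>F"

text \<open>Truth values are booleans: \<open>False\<close> is 0 and \<open>True\<close> is 1. Hence \<open>lit_pow x False\<close> is
  \<open>x\<close> and \<open>lit_pow x True\<close> is its negation: \<open>lit_pow x e\<close> is the literal that becomes false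
  when \<open>x\<close> is set to \<open>e\<close>.\<close>

definition lit_pow :: "'v \<Rightarrow> bool \<Rightarrow> 'v literal" where
  "lit_pow x e = (if e then Neg x else Pos x)"

type_synonym 'v assignment = "'v \<rightharpoonup> bool"

fun lit_val :: "'v assignment \<Rightarrow> 'v literal \<Rightarrow> bool option" where
  "lit_val \<alpha> (Pos x) = \<alpha> x"
| "lit_val \<alpha> (Neg x) = map_option Not (\<alpha> x)"

definition clause_false :: "'v clause \<Rightarrow> 'v assignment \<Rightarrow> bool" where
  "clause_false C \<alpha> \<longleftrightarrow> (\<forall>l\<in>C. lit_val \<alpha> l = Some False)"

definition formula_true :: "'v clause set \<Rightarrow> 'v assignment \<Rightarrow> bool" where
  "formula_true F \<alpha> \<longleftrightarrow> (\<forall>C\<in>F. \<exists>l\<in>C. lit_val \<alpha> l = Some True)"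

definition formula_false :: "'v clause set \<Rightarrow> 'v assignment \<Rightarrow> bool" where
  "formula_false F \<alpha> \<longleftrightarrow> (\<exists>C\<in>F. clause_false C \<alpha>)"


section \<open>The procedure DLL-Learn\<close>

text \<open>\<open>Unsat C\<close> is the answer UNSAT together with the clause \<open>C\<close> tagged as new by the call.\<close>

datatype 'v answer = Sat "'v assignment" | Unsat "'v clause"

text \<open>\<open>dll_learn F \<alpha> H r n\<close>: some execution of DLL-Learn on \<open>(F, \<alpha>)\<close> returns the clause set \<open>H\<close>
  and the answer \<open>r\<close>, and performs exactly \<open>n\<close> recursive calls in total (calls at all depths,
  the call on \<open>(F, \<alpha>)\<close> itself not counted).\<close>

inductive dll_learn ::
  "'v clause set \<Rightarrow> 'v assignment \<Rightarrow> 'v clause set \<Rightarrow> 'v answer \<Rightarrow> nat \<Rightarrow> bool" where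
  sat: "formula_true F \<alpha> \<Longrightarrow> dll_learn F \<alpha> F (Sat \<alpha>) 0"
| conflict: "\<lbrakk>\<not> formula_true F \<alpha>; C \<in> F; clause_false C \<alpha>\<rbrakk>
    \<Longrightarrow> dll_learn F \<alpha> F (Unsat C) 0"
| branch_sat_first: "\<lbrakk>\<not> formula_true F \<alpha>; \<not> (formula_false F \<alpha> \<and> vars F \<subseteq> dom \<alpha>);
      x \<in> vars F - dom \<alpha>;
      dll_learn F (\<alpha>(x \<mapsto> e)) G (Sat \<beta>) m\<rbrakk>
    \<Longrightarrow> dll_learn F \<alpha> G (Sat \<beta>) (m + 1)"
| branch_sat_second: "\<lbrakk>\<not> formula_true F \<alpha>; \<not> (formula_false F \<alpha> \<and> vars F \<subseteq> dom \<alpha>);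
      x \<in> vars F - dom \<alpha>;
      dll_learn F (\<alpha>(x \<mapsto> e)) G (Unsat C0) m;
      dll_learn G (\<alpha>(x \<mapsto> \<not> e)) H (Sat \<gamma>) n\<rbrakk>
    \<Longrightarrow> dll_learn F \<alpha> H (Sat \<gamma>) (m + n + 2)"
| branch_unsat: "\<lbrakk>\<not> formula_true F \<alpha>; \<not> (formula_false F \<alpha> \<and> vars F \<subseteq> dom \<alpha>);
      x \<in> vars F - dom \<alpha>;
      dll_learn F (\<alpha>(x \<mapsto> e)) G (Unsat C0) m;
      dll_learn G (\<alpha>(x \<mapsto> \<not> e)) H (Unsat C1) n;
      C = (C0 - {lit_pow x e}) \<union> (C1 - {lit_pow x (\<not> e)})\<rbrakk>
    \<Longrightarrow> dll_learn F \<alpha> (H \<union> {C}) (Unsat C) (m + n + 2)"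


section \<open>Regular w-resolution trees with lemmas\<close>

definition w_resolvent :: "'v \<Rightarrow> 'v clause \<Rightarrow> 'v clause \<Rightarrow> 'v clause" where
  "w_resolvent x C0 C1 = (C0 - {Pos x}) \<union> (C1 - {Neg x})"

datatype 'v rtree =
    Leaf "'v clause"
  | Node "'v rtree" 'v "'v clause" "'v rtree"

fun label :: "'v rtree \<Rightarrow> 'v clause" where
  "label (Leaf C) = C"
| "label (Node l x C r) = C"

fun num_nodes :: "'v rtree \<Rightarrow> nat" where
  "num_nodes (Leaf C) = 1"
| "num_nodes (Node l x C r) = num_nodes l + num_nodes r + 1"

text \<open>The nodes of a tree in post-order. A node is represented by the subtree below it; nodes
  with equal subtrees are distinguished by their position in the list, so that node \<open>i\<close>
  precedes node \<open>j\<close> in the post-order iff \<open>i < j\<close>.\<close>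

fun postorder :: "'v rtree \<Rightarrow> 'v rtree list" where
  "postorder (Leaf C) = [Leaf C]"
| "postorder (Node l x C r) = postorder l @ postorder r @ [Node l x C r]"

text \<open>The inference variables along each path between the root and a leaf.\<close>

fun paths :: "'v rtree \<Rightarrow> 'v list set" where
  "paths (Leaf C) = {[]}"
| "paths (Node l x C r) = (#) x ` (paths l \<union> paths r)"

definition regular :: "'v rtree \<Rightarrow> bool" where
  "regular T \<longleftrightarrow> (\<forall>p\<in>paths T. distinct p)"

text \<open>Either child may be the premise from which the positive literal is removed: the order of
  the children only matters for the availability of lemmas.

  The inference variables are variables of \<open>F\<close>. If w-resolution on foreign variables were
  allowed, \<open>{{}}\<close> would have a refutation with three nodes, whereas DLL-Learn, which only
  branches on variables of \<open>F\<close>, makes no recursive call on it.\<close>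

definition regWRTL_refutation :: "'v clause set \<Rightarrow> 'v rtree \<Rightarrow> bool" where
  "regWRTL_refutation F T \<longleftrightarrow>
     (\<forall>j < length (postorder T).
        case postorder T ! j of
          Leaf C \<Rightarrow> C \<in> F \<or> (\<exists>i<j. label (postorder T ! i) = C)
        | Node l x C r \<Rightarrow> x \<in> vars F \<and>
            (C = w_resolvent x (label l) (label r) \<or> C = w_resolvent x (label r) (label l))) \<and>
     label T = {} \<and>
     regular T"

end

theory Submission
  imports Defs
begin

text \<open>An execution of DLL-Learn that returns UNSAT and a refutation are the same tree. A call
  on \<open>(G, \<alpha>)\<close> corresponds to a node: \<open>G\<close> consists of \<open>F\<close> and the labels of the nodes preceding
  the subtree in the post-order, \<open>\<alpha>\<close> assigns the inference variables of the proper ancestors,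
  and the label is the clause tagged as new, which \<open>\<alpha>\<close> falsifies. Regularity says that every
  branching variable is unassigned. When a refutation is turned into an execution, no call can
  answer SAT: w-resolution is sound, so an assignment that falsifies a derived clause cannot
  satisfy all the clauses of \<open>G\<close>.\<close>

section \<open>Truth and falsity under partial assignments\<close>

lemma vars_simps [simp]:
  "vars (F \<union> G) = vars F \<union> vars G"
  "vars (insert C F) = var_of ` C \<union> vars F"
  "vars {} = {}"
  by (auto simp: vars_def)

lemma vars_w_resolvent: "var_of ` w_resolvent x C D \<subseteq> var_of ` C \<union> var_of ` D"
  by (auto simp: w_resolvent_def)

lemma formula_true_simps [simp]:
  "formula_true (F \<union> G) \<alpha> \<longleftrightarrow> formula_true F \<alpha> \<and> formula_true G \<alpha>"
  "formula_true (insert C F) \<alpha> \<longleftrightarrow> (\<exists>l\<in>C. lit_val \<alpha> l = Some True) \<and> formula_true F \<alpha>"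
  "formula_true {} \<alpha>"
  by (auto simp: formula_true_def)

lemma lit_val_map_le: "\<alpha> \<subseteq>\<^sub>m \<beta> \<Longrightarrow> lit_val \<alpha> l = Some b \<Longrightarrow> lit_val \<beta> l = Some b"
  unfolding map_le_def by (cases l) (simp_all, (metis domI)+)

lemma formula_true_map_le: "\<alpha> \<subseteq>\<^sub>m \<beta> \<Longrightarrow> formula_true F \<alpha> \<Longrightarrow> formula_true F \<beta>"
  unfolding formula_true_def by (meson lit_val_map_le)

lemma clause_false_map_le: "\<alpha> \<subseteq>\<^sub>m \<beta> \<Longrightarrow> clause_false C \<alpha> \<Longrightarrow> clause_false C \<beta>"
  unfolding clause_false_def by (meson lit_val_map_le)

lemma clause_false_not_true: "clause_false C \<alpha> \<Longrightarrow> C \<in> F \<Longrightarrow> \<not> formula_true F \<alpha>"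
  by (force simp: clause_false_def formula_true_def)

lemma clause_false_empty_map: "clause_false C Map.empty \<longleftrightarrow> C = {}"
proof -
  have "lit_val Map.empty l \<noteq> Some False" for l :: "'v literal"
    by (cases l) auto
  then show ?thesis
    by (auto simp: clause_false_def)
qed

text \<open>As \<open>x\<close> is unassigned, giving it the value \<open>e\<close> makes
  \<open>lit_pow x e\<close> false and its complement true, and changes no other literal. This is
  why descending into a branch matches undoing one side of a w-resolution.\<close>

lemma clause_false_upd_iff:
  assumes "x \<notin> dom \<alpha>"
  shows "clause_false C (\<alpha>(x \<mapsto> e)) \<longleftrightarrow> clause_false (C - {lit_pow x e}) \<alpha>"
proof -
  have "\<alpha> x = None" using assms by auto
  then have "lit_val (\<alpha>(x \<mapsto> e)) l = Some False \<longleftrightarrow> l = lit_pow x e \<or> lit_val \<alpha> l = Some False"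
    for l
    by (cases l; cases e) (auto simp: lit_pow_def)
  then show ?thesis
    by (auto simp: clause_false_def)
qed

text \<open>The value of \<open>x\<close> falsifies one of the two removed literals; the true
  literal of the premise that lost it therefore survives.\<close>

lemma w_resolvent_sound:
  assumes "x \<in> dom \<alpha>" "formula_true {C, D} \<alpha>"
  shows "formula_true {w_resolvent x C D} \<alpha>"
proof -
  obtain b where "\<alpha> x = Some b" using assms(1) by auto
  moreover obtain k l where "k \<in> C" "lit_val \<alpha> k = Some True" "l \<in> D" "lit_val \<alpha> l = Some True"
    using assms(2) by auto
  ultimately have "if b then l \<in> D - {Neg x} \<and> lit_val \<alpha> l = Some True
      else k \<in> C - {Pos x} \<and> lit_val \<alpha> k = Some True"
    by auto
  then show ?thesis
    by (cases b) (auto simp: w_resolvent_def)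
qed

text \<open>The choice between the two orders of the premises is the choice of the value
  \<open>e\<close> that DLL-Learn tries first.\<close>

lemma w_resolvent_iff_lit_pow:
  "C = w_resolvent x D E \<or> C = w_resolvent x E D \<longleftrightarrow>
     (\<exists>e. C = (D - {lit_pow x e}) \<union> (E - {lit_pow x (\<not> e)}))"
  by (simp add: ex_bool_eq lit_pow_def w_resolvent_def Un_commute disj_commute)

section \<open>Refutations by recursion on the tree\<close>

definition labels :: "'v rtree \<Rightarrow> 'v clause set" where
  "labels T = label ` set (postorder T)"

lemma labels_simps [simp]:
  "labels (Leaf C) = {C}"
  "labels (Node l x C r) = insert C (labels l \<union> labels r)"
  by (auto simp: labels_def)

lemma label_in_labels [simp]: "label T \<in> labels T"
  by (cases T) auto

text \<open>\<open>V\<close> is the set of admissible inference variables, \<open>L\<close> the set of clauses available at the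
  first leaf.\<close>

fun derivation :: "'v set \<Rightarrow> 'v clause set \<Rightarrow> 'v rtree \<Rightarrow> bool" where
  "derivation V L (Leaf C) \<longleftrightarrow> C \<in> L"
| "derivation V L (Node l x C r) \<longleftrightarrow> derivation V L l \<and> derivation V (L \<union> labels l) r \<and> x \<in> V \<and>
     (C = w_resolvent x (label l) (label r) \<or> C = w_resolvent x (label r) (label l))"

definition inference :: "'v set \<Rightarrow> 'v clause set \<Rightarrow> 'v rtree \<Rightarrow> bool" where
  "inference V L t = (case t of
       Leaf C \<Rightarrow> C \<in> L
     | Node l x C r \<Rightarrow> x \<in> V \<and>
         (C = w_resolvent x (label l) (label r) \<or> C = w_resolvent x (label r) (label l)))"

text \<open>\<open>P\<close> sees an entry together with all entries before it, just as a leaf sees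
  the nodes preceding it; on the second list \<open>xs\<close> is therefore part of the
  history.\<close>

lemma all_prefixes_append:
  "(\<forall>j < length (xs @ ys). P (take j (xs @ ys)) ((xs @ ys) ! j)) \<longleftrightarrow>
     (\<forall>j < length xs. P (take j xs) (xs ! j)) \<and> (\<forall>j < length ys. P (xs @ take j ys) (ys ! j))"
  (is "?lhs \<longleftrightarrow> ?rhs")
proof
  assume l: ?lhs
  have "P (take j xs) (xs ! j)" if "j < length xs" for j
    using l[rule_format, of j] that by (simp add: nth_append)
  moreover have "P (xs @ take j ys) (ys ! j)" if "j < length ys" for j
    using l[rule_format, of "length xs + j"] that by simp
  ultimately show ?rhs by blast
next
  assume r: ?rhs
  show ?lhs
  proof (intro allI impI)
    fix j assume j: "j < length (xs @ ys)"
    show "P (take j (xs @ ys)) ((xs @ ys) ! j)"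
    proof (cases "j < length xs")
      case True
      then show ?thesis using r by (simp add: nth_append)
    next
      case False
      then show ?thesis using r j by (simp add: nth_append)
    qed
  qed
qed

lemma derivation_iff_postorder:
  "derivation V L T \<longleftrightarrow> (\<forall>j < length (postorder T).
     inference V (L \<union> label ` set (take j (postorder T))) (postorder T ! j))"
proof (induction T arbitrary: L)
  case (Leaf C)
  then show ?case by (simp add: inference_def)
next
  case (Node l x C r)
  let ?P = "\<lambda>ts t. inference V (L \<union> label ` set ts) t"
  have "derivation V (L \<union> labels l) r \<longleftrightarrow> (\<forall>j < length (postorder r).
      ?P (postorder l @ take j (postorder r)) (postorder r ! j))"
    by (simp add: Node.IH(2) labels_def image_Un Un_assoc)
  moreover have "(\<forall>j < length [Node l x C r]. ?P (postorder l @ postorder r @ take j [Node l x C r])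
      ([Node l x C r] ! j)) \<longleftrightarrow> x \<in> V \<and>
      (C = w_resolvent x (label l) (label r) \<or> C = w_resolvent x (label r) (label l))"
    by (simp add: inference_def)
  \<comment> \<open>The post-order is a concatenation of three lists, so it is split twice, the
    second time with \<open>postorder l\<close> as a fixed history.\<close>
  ultimately show ?case
    unfolding postorder.simps derivation.simps
    by (subst all_prefixes_append[where P = ?P],
        subst all_prefixes_append[where P = "\<lambda>ts. ?P (postorder l @ ts)"])
      (simp only: Node.IH(1))
qed

text \<open>\<open>D\<close> collects the inference variables of the proper ancestors, which turns
  regularity into a recursive condition; \<open>D\<close> later becomes
  \<open>dom \<alpha>\<close>.\<close>

definition regular_avoiding :: "'v set \<Rightarrow> 'v rtree \<Rightarrow> bool" where
  "regular_avoiding D T \<longleftrightarrow> (\<forall>p\<in>paths T. distinct p \<and> set p \<inter> D = {})"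

lemma paths_nonempty: "paths T \<noteq> {}"
  by (induction T) auto

lemma regular_avoiding_simps [simp]:
  "regular_avoiding D (Leaf C)"
  "regular_avoiding D (Node l x C r) \<longleftrightarrow>
     x \<notin> D \<and> regular_avoiding (insert x D) l \<and> regular_avoiding (insert x D) r"
  \<comment> \<open>Without a path through the node, the condition on its paths would not give
    \<open>x \<notin> D\<close>.\<close>
  using paths_nonempty[of l] by (auto simp: regular_avoiding_def)

lemma regWRTL_refutation_iff:
  "regWRTL_refutation F T \<longleftrightarrow> derivation (vars F) F T \<and> label T = {} \<and> regular_avoiding {} T"
proof -
  have "inference (vars F) (F \<union> label ` set (take j ts)) (ts ! j) \<longleftrightarrow>
      (case ts ! j of
          Leaf C \<Rightarrow> C \<in> F \<or> (\<exists>i<j. label (ts ! i) = C)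
        | Node l x C r \<Rightarrow> x \<in> vars F \<and>
            (C = w_resolvent x (label l) (label r) \<or> C = w_resolvent x (label r) (label l)))"
    if "j < length ts" for j ts
    using that nth_image[of j ts, symmetric]
    by (auto simp: inference_def image_image split: rtree.split)
  then show ?thesis
    by (simp add: regWRTL_refutation_def derivation_iff_postorder regular_def
        regular_avoiding_def cong: conj_cong)
qed

section \<open>Variables and soundness of derivations\<close>

lemma derivation_vars:
  "derivation V L T \<Longrightarrow> vars L \<subseteq> V \<Longrightarrow> vars (labels T) \<subseteq> V"
proof (induction T arbitrary: L)
  case (Leaf C)
  then show ?case by (auto simp: vars_def)
next
  case (Node l x C r)
  then have l: "vars (labels l) \<subseteq> V" by auto
  have r: "vars (labels r) \<subseteq> V"
    using Node.prems l by (intro Node.IH(2)[of "L \<union> labels l"]) auto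
  have "var_of ` label t \<subseteq> vars (labels t)" for t :: "'a rtree"
    using label_in_labels[of t] unfolding vars_def by blast
  then have "var_of ` label l \<subseteq> V" "var_of ` label r \<subseteq> V"
    using l r by blast+
  then have "var_of ` w_resolvent x (label l) (label r) \<subseteq> V"
      "var_of ` w_resolvent x (label r) (label l) \<subseteq> V"
    by (auto intro!: order_trans[OF vars_w_resolvent])
  then have "var_of ` C \<subseteq> V"
    using Node.prems(1) by auto
  then show ?case using l r by simp
qed

lemma derivation_sound:
  assumes "derivation V L T" "V \<subseteq> dom \<alpha>" "formula_true L \<alpha>"
  shows "formula_true (labels T) \<alpha>"
  using assms
proof (induction T arbitrary: L)
  case (Leaf C)
  then show ?case by (auto simp: formula_true_def)
next
  case (Node l x C r)
  have l: "formula_true (labels l) \<alpha>" and r: "formula_true (labels r) \<alpha>"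
    using Node by auto
  have "\<exists>k\<in>label t. lit_val \<alpha> k = Some True" if "formula_true (labels t) \<alpha>" for t
    using that by (simp add: formula_true_def)
  then have "formula_true {label l, label r} \<alpha>" "formula_true {label r, label l} \<alpha>"
    using l r by simp_all
  then have "formula_true {C} \<alpha>"
    using Node.prems(1,2) by (auto intro: w_resolvent_sound simp del: formula_true_simps)
  then show ?case using l r by simp
qed

lemma derivation_clause_false_not_true:
  assumes "derivation V L T" "clause_false (label T) \<alpha>"
  shows "\<not> formula_true L \<alpha>"
proof
  \<comment> \<open>Soundness needs every inference variable assigned, so \<open>\<alpha>\<close> is
    completed by the arbitrary default \<open>True\<close>; literals already decided by
    \<open>\<alpha>\<close> keep their values.\<close>
  let ?\<tau> = "(\<lambda>_. Some True) ++ \<alpha>"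
  assume "formula_true L \<alpha>"
  then have "formula_true L ?\<tau>"
    by (rule formula_true_map_le[rotated]) simp
  with assms(1) have "formula_true (labels T) ?\<tau>"
    by (intro derivation_sound[of V L T]) auto
  moreover have "clause_false (label T) ?\<tau>"
    using assms(2) by (rule clause_false_map_le[rotated]) simp
  ultimately show False
    using clause_false_not_true label_in_labels by blast
qed

section \<open>Translations between trees and executions\<close>

lemma num_nodes_pos: "0 < num_nodes T"
  by (cases T) auto

text \<open>The induction runs over all states of the procedure: \<open>L\<close> grows by the
  clauses learned in left subtrees, \<open>\<alpha>\<close> by the branching variables, while
  \<open>vars L\<close> stays equal to \<open>V\<close>.\<close>

lemma derivation_imp_dll_learn:
  assumes "derivation V L T" "vars L = V" "regular_avoiding (dom \<alpha>) T"
    and "clause_false (label T) \<alpha>"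
  shows "dll_learn L \<alpha> (L \<union> labels T) (Unsat (label T)) (num_nodes T - 1)"
  using assms
proof (induction T arbitrary: L \<alpha>)
  case (Leaf C)
  then have "dll_learn L \<alpha> L (Unsat C) 0"
    by (intro dll_learn.conflict clause_false_not_true) auto
  moreover have "L \<union> {C} = L" using Leaf by auto
  ultimately show ?case by simp
next
  case (Node l x C r)
  have x: "x \<in> V" "x \<notin> dom \<alpha>" using Node.prems by auto
  obtain e where C: "C = (label l - {lit_pow x e}) \<union> (label r - {lit_pow x (\<not> e)})"
    using Node.prems(1) unfolding derivation.simps w_resolvent_iff_lit_pow by blast
  \<comment> \<open>Both remainders are subsets of \<open>C\<close>, which \<open>\<alpha>\<close>
    falsifies.\<close>
  have "clause_false (label l - {lit_pow x e}) \<alpha>" "clause_false (label r - {lit_pow x (\<not> e)}) \<alpha>"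
    using Node.prems(4) unfolding label.simps C clause_false_def by blast+
  then have false: "clause_false (label l) (\<alpha>(x \<mapsto> e))" "clause_false (label r) (\<alpha>(x \<mapsto> \<not> e))"
    using x(2) by (simp_all add: clause_false_upd_iff)
  have vars: "vars (L \<union> labels l) = V"
    using derivation_vars[of V L l] Node.prems(1,2) by auto
  have run_l: "dll_learn L (\<alpha>(x \<mapsto> e)) (L \<union> labels l) (Unsat (label l)) (num_nodes l - 1)"
    using Node.prems false by (intro Node.IH(1)) (simp_all del: fun_upd_apply)
  have run_r: "dll_learn (L \<union> labels l) (\<alpha>(x \<mapsto> \<not> e)) (L \<union> labels l \<union> labels r)
      (Unsat (label r)) (num_nodes r - 1)"
    using Node.prems false vars by (intro Node.IH(2)) (simp_all del: fun_upd_apply)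
  \<comment> \<open>This rules out the answer SAT before branching. Stopping is not forced either,
    since \<open>x\<close> is an unassigned variable of \<open>L\<close>.\<close>
  have "\<not> formula_true L \<alpha>"
    using derivation_clause_false_not_true Node.prems(1,4) by blast
  then have "dll_learn L \<alpha> (L \<union> labels l \<union> labels r \<union> {C}) (Unsat C)
      (num_nodes l - 1 + (num_nodes r - 1) + 2)"
    using x Node.prems(2) by (intro dll_learn.branch_unsat[OF _ _ _ run_l run_r C]) auto
  moreover have "num_nodes l - 1 + (num_nodes r - 1) + 2 = num_nodes (Node l x C r) - 1"
    using num_nodes_pos[of l] num_nodes_pos[of r] by simp
  moreover have "L \<union> labels l \<union> labels r \<union> {C} = L \<union> labels (Node l x C r)"
    by auto
  ultimately show ?case by (simp only: label.simps)
qed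

text \<open>Falsification of the tagged clause is carried along because, at the outermost call, it
  forces this clause to be empty.\<close>

lemma dll_learn_imp_derivation:
  assumes "dll_learn F \<alpha> H (Unsat C) n"
  obtains T where "derivation (vars F) F T" "label T = C" "H = F \<union> labels T"
    "num_nodes T = n + 1" "regular_avoiding (dom \<alpha>) T" "clause_false C \<alpha>"
proof -
  have "\<exists>T. derivation (vars F) F T \<and> label T = C \<and> H = F \<union> labels T \<and>
      num_nodes T = n + 1 \<and> regular_avoiding (dom \<alpha>) T \<and> clause_false C \<alpha>"
    using assms
  proof (induction F \<alpha> H "Unsat C" n arbitrary: C rule: dll_learn.induct)
    case (conflict F \<alpha> C)
    then show ?case by (intro exI[of _ "Leaf C"]) auto
  next
    case (branch_unsat F \<alpha> x e G C0 m H C1 n C)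
    obtain l where l: "derivation (vars F) F l" "label l = C0" "G = F \<union> labels l"
        "num_nodes l = m + 1" "regular_avoiding (dom (\<alpha>(x \<mapsto> e))) l" "clause_false C0 (\<alpha>(x \<mapsto> e))"
      using branch_unsat by blast
    obtain r where r: "derivation (vars G) G r" "label r = C1" "H = G \<union> labels r"
        "num_nodes r = n + 1" "regular_avoiding (dom (\<alpha>(x \<mapsto> \<not> e))) r"
        "clause_false C1 (\<alpha>(x \<mapsto> \<not> e))"
      using branch_unsat by blast
    have x: "x \<in> vars F" "x \<notin> dom \<alpha>"
      and C: "C = (C0 - {lit_pow x e}) \<union> (C1 - {lit_pow x (\<not> e)})"
      using branch_unsat.hyps(3,8) by auto
    \<comment> \<open>Learning adds no variables, so the inferences in \<open>r\<close>, admissible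
      over \<open>vars G\<close>, are admissible over \<open>vars F\<close>.\<close>
    have "vars G = vars F"
      using derivation_vars[OF l(1)] l(3) by auto
    moreover have "C = w_resolvent x C0 C1 \<or> C = w_resolvent x C1 C0"
      unfolding w_resolvent_iff_lit_pow using C by blast
    moreover have "clause_false C \<alpha>"
      using l(6) r(6) by (simp add: clause_false_upd_iff[OF x(2)] C) (auto simp: clause_false_def)
    ultimately show ?case
      using l r x by (intro exI[of _ "Node l x C r"]) auto
  qed
  then show ?thesis using that by blast
qed

theorem theorem6p1:
  fixes F :: "'v clause set" and s :: nat
  assumes "clause_set F"
  shows "(\<exists>T. regWRTL_refutation F T \<and> num_nodes T = s) \<longleftrightarrow>
         (\<exists>H C n. dll_learn F Map.empty H (Unsat C) n \<and> int n = int s - 1)"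
proof
  assume "\<exists>T. regWRTL_refutation F T \<and> num_nodes T = s"
  then obtain T where T: "regWRTL_refutation F T" "num_nodes T = s" by blast
  then have "dll_learn F Map.empty (F \<union> labels T) (Unsat (label T)) (num_nodes T - 1)"
    by (intro derivation_imp_dll_learn) (auto simp: regWRTL_refutation_iff clause_false_def)
  \<comment> \<open>A tree has at least one node, so the truncated subtraction agrees with the
    integer one.\<close>
  moreover have "int (num_nodes T - 1) = int s - 1"
    using T(2) num_nodes_pos[of T] by linarith
  ultimately show "\<exists>H C n. dll_learn F Map.empty H (Unsat C) n \<and> int n = int s - 1"
    by blast
next
  assume "\<exists>H C n. dll_learn F Map.empty H (Unsat C) n \<and> int n = int s - 1"
  then obtain H C n where run: "dll_learn F Map.empty H (Unsat C) n" and n: "int n = int s - 1"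
    by blast
  from run obtain T where "derivation (vars F) F T" "label T = C" "num_nodes T = n + 1"
      "regular_avoiding {} T" "clause_false C Map.empty"
    by (rule dll_learn_imp_derivation) auto
  then have "regWRTL_refutation F T \<and> num_nodes T = s"
    using n by (auto simp: regWRTL_refutation_iff clause_false_empty_map)
  then show "\<exists>T. regWRTL_refutation F T \<and> num_nodes T = s" by blast
qed

end
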